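(* For every positive integer $N$, \[ \sum_{\substack{\pi\in\mathcal{U}\\ |\pi|=N}} (-1)^{s(\pi)+\nu_e(\pi)+1}\, 2^{\nu_d(\pi)} \;=\; r_2(N) - 2\chi(N \text{ is a perfect square}). \]
   Context: A partition is a finite non-increasing sequence of positive integers (its parts); $\mathcal{U}$ is the set of all non-empty partitions. For a partition $\pi$: $|\pi|$ is the sum of its parts, $s(\pi)$ its smallest part, $\nu_e(\pi)$ the number of even parts counted with multiplicity, and $\nu_d(\pi)$ the number of distinct part sizes. $r_2(N)$ is the number of pairs $(x,y)\in\mathbb{Z}^2$ with $x^2+y^2=N$. $\chi(S)$ is $1$ if the statement $S$ is true and $0$ otherwise. *)

theory Defs
  imports Complex_Main "HOL-Computational_Algebra.Nth_Powers"
begin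

definition is_partition :: "nat list \<Rightarrow> bool" where
  "is_partition p \<longleftrightarrow> sorted_wrt (\<ge>) p \<and> (\<forall>x\<in>set p. 0 < x)"

definition nonempty_partitions :: "nat list set" where
  "nonempty_partitions = {p. is_partition p \<and> p \<noteq> []}"

(* Only meaningful on non-empty partitions. *)
definition smallest_part :: "nat list \<Rightarrow> nat" where
  "smallest_part p = Min (set p)"

definition num_even_parts :: "nat list \<Rightarrow> nat" where
  "num_even_parts p = length (filter even p)"

definition num_distinct_parts :: "nat list \<Rightarrow> nat" where
  "num_distinct_parts p = card (set p)"

definition r2 :: "nat \<Rightarrow> nat" where
  "r2 N = card {(x :: int, y :: int). x\<^sup>2 + y\<^sup>2 = int N}"

text \<open>The index sets of the sum over partitions and of the cardinality in \<^const>\<open>r2\<close> are finite,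
  so neither takes the default value 0 used for infinite sets.\<close>

lemma finite_nonempty_partitions_of: "finite {p \<in> nonempty_partitions. sum_list p = N}"
proof (rule finite_subset)
  have len: "length p \<le> sum_list p" if "\<forall>x\<in>set p. 0 < x" for p :: "nat list"
    using that by (induction p) auto
  show "{p \<in> nonempty_partitions. sum_list p = N} \<subseteq> {p. set p \<subseteq> {..N} \<and> length p \<le> N}"
    using len by (auto simp: nonempty_partitions_def is_partition_def intro: member_le_sum_list)
  show "finite {p. set p \<subseteq> {..N} \<and> length p \<le> N}"
    by (rule finite_lists_length_le) simp
qed

lemma finite_two_squares: "finite {(x :: int, y :: int). x\<^sup>2 + y\<^sup>2 = int N}"
proof (rule finite_subset)
  have bnd: "\<bar>x\<bar> \<le> int N" if "x\<^sup>2 + y\<^sup>2 = int N" for x y :: int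
  proof -
    have "\<bar>x\<bar> \<le> x\<^sup>2"
      by (cases "x = 0") (use self_le_power[of "\<bar>x\<bar>" 2] in auto)
    with that show ?thesis using zero_le_power2[of y] by linarith
  qed
  show "{(x :: int, y :: int). x\<^sup>2 + y\<^sup>2 = int N} \<subseteq> {- int N..int N} \<times> {- int N..int N}"
  proof clarify
    fix x y :: int assume h: "x\<^sup>2 + y\<^sup>2 = int N"
    have "\<bar>x\<bar> \<le> int N" "\<bar>y\<bar> \<le> int N"
      using bnd[OF h] bnd[of y x] h by (simp_all add: add.commute)
    then show "x \<in> {- int N..int N} \<and> y \<in> {- int N..int N}" by auto
  qed
qed simp

end

(*
  Since (-1)^(number of odd parts) = (-1)^N, replacing q by t = -q turns the sum over partitions
  into the coefficient of t^N in the sum over m of (-1)^(m+1) H_m.  Here H_m generates the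
  partitions with smallest part m, weighted by (-1)^(number of parts) 2^(number of part sizes).
  With G = prod (1 - t^j)/(1 + t^j), removing one copy of the smallest part gives
  (-1)^(m+1) H_m = G c_m t^m, where c_m = (-1)^m (-1;t)_m/(t;t)_m.  The q-binomial theorem for
  sum c_m x^m at x = t turns the sum of these terms over m >= 1 into G (G - 1).  By Gauss,
  G = sum (-1)^k t^(k^2) over all integers k, so G^2 - G has coefficients
  (-1)^N (r2 N - 2 [N is a square]) for N > 0.
*)
theory Submission
  imports Defs "HOL-Computational_Algebra.Formal_Power_Series"
begin
unbundle fps_syntax


section \<open>Power series agreeing up to a given degree\<close>

text \<open>Congruence modulo \<open>fps_X ^ Suc n\<close>. Under it finite truncations stand in for
  infinite sums and products, so no convergence has to be discussed.\<close>

definition eq_upto :: "nat \<Rightarrow> 'a::zero fps \<Rightarrow> 'a fps \<Rightarrow> bool" where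
  "eq_upto n f g \<longleftrightarrow> (\<forall>i\<le>n. f $ i = g $ i)"

lemma eq_upto_refl [simp]: "eq_upto n f f"
  by (simp add: eq_upto_def)

lemma eq_upto_sym: "eq_upto n f g \<Longrightarrow> eq_upto n g f"
  by (simp add: eq_upto_def)

lemma eq_upto_trans [trans]: "eq_upto n f g \<Longrightarrow> eq_upto n g h \<Longrightarrow> eq_upto n f h"
  by (simp add: eq_upto_def)

lemma eq_upto_diff:
  fixes f :: "'a::ab_group_add fps"
  shows "eq_upto n f f' \<Longrightarrow> eq_upto n g g' \<Longrightarrow> eq_upto n (f - g) (f' - g')"
  by (simp add: eq_upto_def)

lemma eq_upto_mult:
  fixes f :: "'a::comm_ring_1 fps"
  shows "eq_upto n f f' \<Longrightarrow> eq_upto n g g' \<Longrightarrow> eq_upto n (f * g) (f' * g')"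
  by (auto simp: eq_upto_def fps_mult_nth intro!: sum.cong)

lemma eq_upto_cancel:
  fixes u :: "'a::field fps"
  assumes "u $ 0 \<noteq> 0" "eq_upto n (u * f) (u * g)"
  shows "eq_upto n f g"
proof -
  have "eq_upto n (inverse u * (u * f)) (inverse u * (u * g))"
    by (rule eq_upto_mult[OF eq_upto_refl assms(2)])
  then show ?thesis
    by (simp only: mult.assoc[symmetric] inverse_mult_eq_1[OF assms(1)] mult_1_left)
qed

lemma eq_upto_diff_mult_X_power:
  fixes f :: "'a::comm_ring_1 fps"
  shows "n < k \<Longrightarrow> eq_upto n (f - g * fps_X ^ k) f"
  by (simp add: eq_upto_def fps_X_power_mult_right_nth)

lemma one_plus_X_power_Suc_nonzero: "(1 + fps_X ^ Suc k :: 'a::comm_ring_1 fps) \<noteq> 0"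
proof
  assume "(1 + fps_X ^ Suc k :: 'a fps) = 0"
  then have "(1 + fps_X ^ Suc k :: 'a fps) $ 0 = 0" by simp
  then show False by simp
qed

lemma one_minus_X_power_Suc_nonzero: "(1 - fps_X ^ Suc k :: 'a::comm_ring_1 fps) \<noteq> 0"
proof
  assume "(1 - fps_X ^ Suc k :: 'a fps) = 0"
  then have "(1 - fps_X ^ Suc k :: 'a fps) $ 0 = 0" by simp
  then show False by simp
qed

section \<open>The q-binomial series and its functional equation\<close>

fun binom_coeff :: "nat \<Rightarrow> 'a::field fps" where
  "binom_coeff 0 = 1"
| "binom_coeff (Suc j) = - binom_coeff j * (1 + fps_X ^ j) * inverse (1 - fps_X ^ Suc j)"

lemma binom_coeff_Suc:
  "binom_coeff (Suc j) * (1 - fps_X ^ Suc j) = - binom_coeff j * (1 + fps_X ^ j)"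
proof -
  have "inverse (1 - fps_X ^ Suc j) * (1 - fps_X ^ Suc j :: 'a fps) = 1"
    by (rule inverse_mult_eq_1) simp
  then show ?thesis by (simp add: mult.assoc del: power_Suc)
qed

text \<open>Writing t for \<open>fps_X\<close>, this truncates the q-binomial series of the product
  over i >= 0 of (1 - x t^i)/(1 + x t^i).\<close>

definition binom_sum :: "nat \<Rightarrow> 'a::field fps \<Rightarrow> 'a fps" where
  "binom_sum n x = (\<Sum>j<n. binom_coeff j * x ^ j)"

text \<open>Comparing coefficients of x^j gives exactly the recurrence
  \<open>binom_coeff_Suc\<close>; cutting the series off leaves a single boundary term at
  x^n.\<close>

lemma binom_sum_functional_equation:
  "(1 + x) * binom_sum n x =
     (1 - x) * binom_sum n (fps_X * x) - binom_coeff n * (1 - fps_X ^ n) * x ^ n"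
proof (induction n)
  case 0
  then show ?case by (simp add: binom_sum_def)
next
  case (Suc n)
  have "(1 + x) * binom_sum (Suc n) x
      = (1 + x) * binom_sum n x + (1 + x) * binom_coeff n * x ^ n"
    by (simp add: binom_sum_def algebra_simps)
  also have "\<dots> = (1 - x) * binom_sum n (fps_X * x) - binom_coeff n * (1 - fps_X ^ n) * x ^ n
      + (1 + x) * binom_coeff n * x ^ n"
    by (simp only: Suc.IH)
  also have "\<dots> = (1 - x) * binom_sum (Suc n) (fps_X * x)
      - (- binom_coeff n * (1 + fps_X ^ n)) * x ^ Suc n"
    by (simp add: binom_sum_def algebra_simps power_mult_distrib)
  finally show ?case by (simp only: binom_coeff_Suc)
qed

section \<open>Gauss's product for the theta series\<close>

fun gauss_prod :: "nat \<Rightarrow> 'a::field fps" where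
  "gauss_prod 0 = 1"
| "gauss_prod (Suc n) = gauss_prod n * (1 - fps_X ^ Suc n) * inverse (1 + fps_X ^ Suc n)"

lemma gauss_prod_Suc:
  "gauss_prod (Suc n) * (1 + fps_X ^ Suc n) = gauss_prod n * (1 - fps_X ^ Suc n)"
proof -
  have "inverse (1 + fps_X ^ Suc n) * (1 + fps_X ^ Suc n :: 'a fps) = 1"
    by (rule inverse_mult_eq_1) simp
  then show ?thesis by (simp add: mult.assoc del: power_Suc)
qed

text \<open>The factors 1 - t^j cancel, and so do the factors 1 + t^j with 0 < j < n. Of (-1;t)_n
  only its first factor 1 + t^0 = 2 survives.\<close>

lemma gauss_prod_mult_binom_coeff:
  "gauss_prod n * binom_coeff n * (1 + fps_X ^ n) = 2 * (- 1) ^ n"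
proof (induction n)
  case 0
  then show ?case by simp
next
  case (Suc n)
  let ?u = "1 - fps_X ^ Suc n :: 'a fps"
  have u: "?u \<noteq> 0"
    by (rule one_minus_X_power_Suc_nonzero)
  have "gauss_prod (Suc n) * binom_coeff (Suc n) * (1 + fps_X ^ Suc n) * ?u
      = (gauss_prod (Suc n) * (1 + fps_X ^ Suc n)) * (binom_coeff (Suc n) * ?u)"
    by (simp only: mult_ac)
  also have "\<dots> = - (gauss_prod n * binom_coeff n * (1 + fps_X ^ n)) * ?u"
    unfolding gauss_prod_Suc binom_coeff_Suc by (simp only: mult_ac mult_minus_left mult_minus_right)
  also have "\<dots> = 2 * (- 1) ^ Suc n * ?u"
    unfolding Suc.IH by simp
  finally show ?case using u by (simp only: mult_cancel_right) simp
qed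

text \<open>The symmetric integer range makes the square of this series a sum over lattice points,
  as needed for \<open>r2\<close>.\<close>

definition theta :: "nat \<Rightarrow> 'a::field fps" where
  "theta n = (\<Sum>k\<in>{- int n..int n}. (- 1) ^ nat \<bar>k\<bar> * fps_X ^ nat (k\<^sup>2))"

lemma theta_0: "theta 0 = 1"
  by (simp add: theta_def)

lemma theta_Suc: "theta (Suc n) = theta n + 2 * (- 1) ^ Suc n * fps_X ^ (Suc n)\<^sup>2"
proof -
  have *: "{- int (Suc n)..int (Suc n)} = insert (int (Suc n)) (insert (- int (Suc n)) {- int n..int n})"
    by auto
  have "nat ((int (Suc n))\<^sup>2) = (Suc n)\<^sup>2" "nat ((- int (Suc n))\<^sup>2) = (Suc n)\<^sup>2"
    by (simp_all add: nat_power_eq del: of_nat_Suc)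
  then show ?thesis
    unfolding theta_def * by (simp add: algebra_simps del: of_nat_Suc power_Suc)
qed

text \<open>The truncation of the sum is chosen so that its increments telescope; letting \<open>n\<close>
  grow yields Gauss's product for the theta series.\<close>
lemma gauss_prod_mult_binom_sum:
  "gauss_prod n * binom_sum (Suc n) (fps_X ^ Suc n) = theta n"
proof (induction n)
  case 0
  then show ?case by (simp add: binom_sum_def theta_0)
next
  case (Suc n)
  let ?y = "fps_X ^ Suc n :: 'a fps"
  let ?P = "gauss_prod (Suc n) :: 'a fps"
  let ?c = "binom_coeff (Suc n) :: 'a fps"
  have u: "1 - ?y \<noteq> 0"
    by (rule one_minus_X_power_Suc_nonzero)
  have "(1 - ?y) * theta n = (gauss_prod n * (1 - ?y)) * binom_sum (Suc n) ?y"
    unfolding Suc.IH[symmetric] by (simp only: mult_ac)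
  also have "\<dots> = ?P * ((1 + ?y) * binom_sum (Suc n) ?y)"
    unfolding gauss_prod_Suc[symmetric] by (simp only: mult_ac)
  \<comment> \<open>At x = t^(n+1) the boundary term of the functional equation carries the factor 1
    - x itself, so 1 - x can be cancelled throughout.\<close>
  also have "\<dots> = (1 - ?y) * (?P * (binom_sum (Suc n) (fps_X * ?y) - ?c * ?y ^ Suc n))"
    unfolding binom_sum_functional_equation by (simp only: algebra_simps)
  finally have eq: "theta n = ?P * (binom_sum (Suc n) (fps_X * ?y) - ?c * ?y ^ Suc n)"
    using u by (simp only: mult_cancel_left) simp
  have "?P * binom_sum (Suc (Suc n)) (fps_X * ?y)
      = ?P * (binom_sum (Suc n) (fps_X * ?y) + ?c * (fps_X * ?y) ^ Suc n)"
    by (simp only: binom_sum_def sum.lessThan_Suc)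
  \<comment> \<open>The boundary term and the newly added summand combine into the factor 1 +
    t^(n+1), which completes the product in \<open>gauss_prod_mult_binom_coeff\<close>.\<close>
  also have "\<dots> = theta n + (?P * ?c * (1 + ?y)) * ?y ^ Suc n"
    unfolding eq power_mult_distrib by (simp only: algebra_simps mult_1_left)
  also have "\<dots> = theta (Suc n)"
    unfolding gauss_prod_mult_binom_coeff theta_Suc
    by (simp only: power2_eq_square power_mult)
  finally show ?case by (simp only: power_Suc)
qed

text \<open>All summands except the one for j = 0 are divisible by t^(n+1).\<close>

lemma binom_sum_X_power: "eq_upto n (binom_sum (Suc m) (fps_X ^ Suc n)) 1"
proof -
  have "(\<Sum>j<Suc m. binom_coeff j * (fps_X ^ Suc n) ^ j) $ i = (1 :: 'a fps) $ i" if "i \<le> n" for i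
  proof -
    have "(binom_coeff (Suc j) * (fps_X ^ Suc n) ^ Suc j :: 'a fps) $ i = 0" for j
      unfolding power_mult[symmetric] fps_X_power_mult_right_nth using that by simp
    then show ?thesis
      unfolding sum.lessThan_Suc_shift fps_add_nth fps_sum_nth by simp
  qed
  then show ?thesis by (simp add: eq_upto_def binom_sum_def)
qed

lemma gauss_prod_eq_theta: "eq_upto n (gauss_prod n) (theta n)"
proof -
  have "eq_upto n (gauss_prod n * binom_sum (Suc n) (fps_X ^ Suc n)) (gauss_prod n * 1 :: 'a fps)"
    by (intro eq_upto_mult binom_sum_X_power eq_upto_refl)
  then show ?thesis by (simp only: gauss_prod_mult_binom_sum mult_1_right eq_upto_sym)
qed

text \<open>Iterating the functional equation from x = t moves the argument to t^(k+1) and collects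
  the factors of \<open>gauss_prod k\<close>; at k = n the finite identity applies.\<close>

lemma binom_sum_X_eq_theta: "eq_upto n (binom_sum (Suc n) fps_X) (theta n)"
proof -
  have "eq_upto n (binom_sum (Suc n) fps_X)
          (gauss_prod k * binom_sum (Suc n) (fps_X ^ Suc k) :: 'a fps)" for k
  proof (induction k)
    case 0
    then show ?case by simp
  next
    case (Suc k)
    let ?x = "fps_X ^ Suc k :: 'a fps"
    let ?S = "binom_sum (Suc n) :: 'a fps \<Rightarrow> _"
    let ?c = "binom_coeff (Suc n) * (1 - fps_X ^ Suc n) :: 'a fps"
    \<comment> \<open>The boundary term has order at least (k+1)(n+1) > n, hence is invisible up to
      degree n.\<close>
    have "eq_upto n ((1 - ?x) * ?S (fps_X * ?x) - ?c * fps_X ^ (Suc k * Suc n))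
            ((1 - ?x) * ?S (fps_X * ?x))"
      by (rule eq_upto_diff_mult_X_power) simp
    then have "eq_upto n ((1 + ?x) * ?S ?x) ((1 - ?x) * ?S (fps_X * ?x))"
      unfolding binom_sum_functional_equation power_mult .
    then have "eq_upto n (gauss_prod k * ((1 + ?x) * ?S ?x))
                 (gauss_prod k * ((1 - ?x) * ?S (fps_X * ?x)))"
      by (rule eq_upto_mult[OF eq_upto_refl])
    also have "gauss_prod k * ((1 - ?x) * ?S (fps_X * ?x))
                 = (1 + ?x) * (gauss_prod (Suc k) * ?S (fps_X * ?x))"
      using gauss_prod_Suc[of k, where 'a='a] by (simp only: mult.assoc[symmetric]) (simp only: mult_ac)
    also have "gauss_prod k * ((1 + ?x) * ?S ?x) = (1 + ?x) * (gauss_prod k * ?S ?x)"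
      by (simp only: mult_ac)
    finally have "eq_upto n (gauss_prod k * ?S ?x) (gauss_prod (Suc k) * ?S (fps_X * ?x))"
      by (rule eq_upto_cancel[rotated]) simp
    with Suc.IH show ?case
      unfolding power_Suc[of _ "Suc k"] by (rule eq_upto_trans)
  qed
  also have "eq_upto n (gauss_prod n * binom_sum (Suc n) (fps_X ^ Suc n)) (theta n :: 'a fps)"
    by (simp only: gauss_prod_mult_binom_sum eq_upto_refl)
  finally show ?thesis .
qed

section \<open>Generating functions of signed, weighted partitions\<close>

definition parts_from :: "nat \<Rightarrow> nat \<Rightarrow> nat list set" where
  "parts_from m n = {p. is_partition p \<and> (\<forall>x\<in>set p. m \<le> x) \<and> sum_list p = n}"

definition part_weight :: "nat list \<Rightarrow> 'a::comm_ring_1" where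
  "part_weight p = (- 1) ^ length p * 2 ^ card (set p)"

definition parts_gf :: "nat \<Rightarrow> 'a::comm_ring_1 fps" where
  "parts_gf m = Abs_fps (\<lambda>n. \<Sum>p\<in>parts_from m n. part_weight p)"

definition smallest_gf :: "nat \<Rightarrow> 'a::comm_ring_1 fps" where
  "smallest_gf m = Abs_fps (\<lambda>n. \<Sum>p | p \<in> parts_from m n \<and> m \<in> set p. part_weight p)"

lemma finite_parts_from: "finite (parts_from m n)"
proof (rule finite_subset)
  show "parts_from m n \<subseteq> insert [] {p \<in> nonempty_partitions. sum_list p = n}"
    by (auto simp: parts_from_def nonempty_partitions_def)
qed (use finite_nonempty_partitions_of in blast)

lemma parts_from_Suc: "parts_from (Suc m) n = {p \<in> parts_from m n. m \<notin> set p}"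
  by (auto simp: parts_from_def Suc_le_eq le_less)

lemma parts_gf_split: "parts_gf m = parts_gf (Suc m) + smallest_gf m"
proof (rule fps_ext)
  fix n
  have "parts_from m n = parts_from (Suc m) n \<union> {p \<in> parts_from m n. m \<in> set p}"
    by (auto simp: parts_from_Suc)
  moreover have "parts_from (Suc m) n \<inter> {p \<in> parts_from m n. m \<in> set p} = {}"
    by (auto simp: parts_from_Suc)
  ultimately show "parts_gf m $ n = (parts_gf (Suc m) + smallest_gf m :: 'a fps) $ n"
    by (simp add: parts_gf_def smallest_gf_def finite_parts_from flip: sum.union_disjoint)
qed

text \<open>Parts are listed in non-increasing order, so a minimal part m stands last. Only one copy
  is removed, and the rest may still contain m.\<close>

lemma parts_with_smallest_eq:
  assumes "m > 0"
  shows "{p \<in> parts_from m n. m \<in> set p} =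
           (if m \<le> n then (\<lambda>p. p @ [m]) ` parts_from m (n - m) else {})" (is "?L = ?R")
proof (intro equalityI subsetI)
  fix p assume p: "p \<in> ?L"
  then obtain p' x where px: "p = p' @ [x]" by (cases p rule: rev_cases) auto
  with p have "x = m" by (auto simp: parts_from_def is_partition_def sorted_wrt_append intro: antisym)
  with p px show "p \<in> ?R"
    by (auto simp: parts_from_def is_partition_def sorted_wrt_append)
next
  fix p assume "p \<in> ?R"
  with assms show "p \<in> ?L"
    by (auto simp: parts_from_def is_partition_def sorted_wrt_append split: if_splits)
qed

lemma part_weight_snoc:
  "part_weight (p @ [m]) = - (if m \<in> set p then part_weight p else 2 * part_weight p)"
  by (simp add: part_weight_def insert_absorb)

text \<open>Removing one copy of the smallest part flips the sign, and it halves the weight exactly when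
  that part was not repeated.\<close>
lemma smallest_gf_rec:
  assumes "m > 0"
  shows "smallest_gf m = - (smallest_gf m + 2 * parts_gf (Suc m)) * fps_X ^ m"
proof (rule fps_ext)
  fix n
  show "smallest_gf m $ n = (- (smallest_gf m + 2 * parts_gf (Suc m)) * fps_X ^ m :: 'a fps) $ n"
  proof (cases "m \<le> n")
    case False
    then show ?thesis
      by (simp only: fps_X_power_mult_right_nth)
        (simp add: smallest_gf_def parts_with_smallest_eq[OF assms])
  next
    case True
    let ?A = "parts_from m (n - m)"
    have "(smallest_gf m :: 'a fps) $ n = (\<Sum>p\<in>?A. part_weight (p @ [m]))"
      using True by (simp add: smallest_gf_def parts_with_smallest_eq[OF assms] sum.reindex inj_on_def)
    also have "\<dots> = - ((\<Sum>p | p \<in> ?A \<and> m \<in> set p. part_weight p)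
                       + (\<Sum>p | p \<in> ?A \<and> m \<notin> set p. 2 * part_weight p))"
      by (simp add: part_weight_snoc sum_negf sum.If_cases finite_parts_from Int_def)
    also have "\<dots> = (- (smallest_gf m + 2 * parts_gf (Suc m)) :: 'a fps) $ (n - m)"
      by (simp add: smallest_gf_def parts_gf_def parts_from_Suc sum_distrib_left
            numeral_fps_const)
    finally show ?thesis
      using True by (simp only: fps_X_power_mult_right_nth) simp
  qed
qed

lemma smallest_gf_eq:
  assumes "m > 0"
  shows "(1 + fps_X ^ m) * smallest_gf m = - 2 * fps_X ^ m * parts_gf (Suc m)"
proof -
  let ?s = "smallest_gf m :: 'a fps" and ?g = "parts_gf (Suc m) :: 'a fps"
  have "(1 + fps_X ^ m) * ?s - - 2 * fps_X ^ m * ?g = ?s - - (?s + 2 * ?g) * fps_X ^ m"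
    by (simp add: algebra_simps)
  also have "\<dots> = 0"
    using smallest_gf_rec[OF assms, where 'a='a] by (simp only: right_minus_eq)
  finally show ?thesis by (simp only: right_minus_eq)
qed

text \<open>The part size m contributes 1 + 2 (-t^m + t^(2m) - ...) = (1 - t^m)/(1 + t^m); the
  denominator is cleared here.\<close>

lemma parts_gf_rec:
  assumes "m > 0"
  shows "(1 + fps_X ^ m) * parts_gf m = (1 - fps_X ^ m) * parts_gf (Suc m)"
  unfolding parts_gf_split[of m] distrib_left smallest_gf_eq[OF assms]
  by (simp add: algebra_simps)

lemma parts_gf_1: "parts_gf 1 = gauss_prod n * parts_gf (Suc n)"
proof (induction n)
  case 0
  then show ?case by simp
next
  case (Suc n)
  let ?u = "1 + fps_X ^ Suc n :: 'a fps"
  have u: "?u \<noteq> 0"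
    by (rule one_plus_X_power_Suc_nonzero)
  have "?u * parts_gf 1 = gauss_prod n * (?u * parts_gf (Suc n))"
    unfolding Suc.IH by (simp only: mult_ac)
  also have "\<dots> = (gauss_prod n * (1 - fps_X ^ Suc n)) * parts_gf (Suc (Suc n))"
    unfolding parts_gf_rec[OF zero_less_Suc] by (simp only: mult_ac)
  also have "\<dots> = ?u * (gauss_prod (Suc n) * parts_gf (Suc (Suc n)))"
    unfolding gauss_prod_Suc[symmetric] by (simp only: mult_ac)
  finally show ?case using u by (simp only: mult_cancel_left) simp
qed

text \<open>The tail \<open>parts_gf (Suc (Suc m))\<close> is \<open>parts_gf 1\<close> divided by
  \<open>gauss_prod (Suc m)\<close>, and this quotient is absorbed into the binomial coefficient.
  The smallest part is m + 1, so its sign (-1)^((m+1)+1) is (-1)^m.\<close>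

lemma smallest_gf_eq_binom_coeff:
  "(- 1) ^ m * smallest_gf (Suc m) = parts_gf 1 * (binom_coeff (Suc m) * fps_X ^ Suc m)"
proof -
  let ?x = "fps_X ^ Suc m :: 'a fps"
  let ?P = "gauss_prod (Suc m) :: 'a fps"
  have u: "1 + ?x \<noteq> 0"
    by (rule one_plus_X_power_Suc_nonzero)
  have "(1 + ?x) * (parts_gf 1 * (binom_coeff (Suc m) * ?x))
      = (?P * binom_coeff (Suc m) * (1 + ?x)) * ?x * parts_gf (Suc (Suc m))"
    unfolding parts_gf_1[of "Suc m"] by (simp only: mult_ac)
  also have "\<dots> = (- 1) ^ m * (- 2 * ?x * parts_gf (Suc (Suc m)))"
    unfolding gauss_prod_mult_binom_coeff by simp
  also have "\<dots> = (1 + ?x) * ((- 1) ^ m * smallest_gf (Suc m))"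
    unfolding smallest_gf_eq[OF zero_less_Suc, symmetric] by (simp only: mult_ac)
  finally show ?thesis using u by (simp only: mult_cancel_left) simp
qed

text \<open>The subtracted 1 is the summand j = 0 of \<open>binom_sum\<close>, which corresponds to
  no smallest part.\<close>

lemma sum_smallest_gf:
  "(\<Sum>m<n. (- 1) ^ m * smallest_gf (Suc m)) = parts_gf 1 * (binom_sum (Suc n) fps_X - 1)"
  unfolding smallest_gf_eq_binom_coeff binom_sum_def sum.lessThan_Suc_shift
  by (simp add: sum_distrib_left)

text \<open>A non-empty partition into parts larger than n has sum larger than n, so only the empty
  one counts.\<close>

lemma parts_gf_Suc_eq_1: "eq_upto n (parts_gf (Suc n)) 1"
proof -
  have "p \<in> parts_from (Suc n) i \<longleftrightarrow> p = [] \<and> i = 0" if "i \<le> n" for p i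
    using that by (cases p) (auto simp: parts_from_def is_partition_def)
  then have "parts_from (Suc n) i = (if i = 0 then {[]} else {})" if "i \<le> n" for i
    using that by auto
  then show ?thesis
    by (auto simp: eq_upto_def parts_gf_def part_weight_def)
qed

lemma parts_gf_1_eq_theta: "eq_upto n (parts_gf 1) (theta n)"
proof -
  have "eq_upto n (gauss_prod n * parts_gf (Suc n)) (theta n * 1 :: 'a fps)"
    by (intro eq_upto_mult gauss_prod_eq_theta parts_gf_Suc_eq_1)
  then show ?thesis by (simp only: parts_gf_1[symmetric] mult_1_right)
qed

lemma sum_smallest_gf_eq_theta:
  "eq_upto n (\<Sum>m<n. (- 1) ^ m * smallest_gf (Suc m)) (theta n * theta n - theta n)"
proof -
  have "eq_upto n (parts_gf 1 * (binom_sum (Suc n) fps_X - 1)) (theta n * (theta n - 1) :: 'a fps)"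
    by (intro eq_upto_mult eq_upto_diff parts_gf_1_eq_theta binom_sum_X_eq_theta eq_upto_refl)
  then show ?thesis by (simp only: sum_smallest_gf right_diff_distrib mult_1_right)
qed

section \<open>Coefficients of the theta series and of its square\<close>

lemma minus_one_power_mult_X_power_nth:
  "((- 1) ^ a * fps_X ^ b :: 'a::comm_ring_1 fps) $ n = (if n = b then (- 1) ^ a else 0)"
proof -
  have "(- 1) ^ a = fps_const ((- 1) ^ a :: 'a)"
    by (simp flip: fps_const_power fps_const_neg)
  then show ?thesis by simp
qed

lemma minus_one_power_cong:
  "(even a \<longleftrightarrow> even b) \<Longrightarrow> (- 1) ^ a = ((- 1) ^ b :: 'a::comm_ring_1)"
  by (auto simp: minus_one_power_iff)

text \<open>Since k and k^2 have the same parity, every contributing sign is (-1)^N. Positivity of N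
  makes the two square roots distinct; for N = 0 the coefficient would be 1.\<close>

lemma theta_nth_self:
  assumes "N > 0"
  shows "theta N $ N = (- 1) ^ N * 2 * (of_bool (is_square N) :: 'a::field)"
proof -
  let ?A = "{k \<in> {- int N..int N}. N = nat (k\<^sup>2)}"
  have par: "even (nat \<bar>k\<bar>) \<longleftrightarrow> even N" if "k \<in> ?A" for k
    using that by (auto simp: even_nat_iff)
  have "theta N $ N = (\<Sum>k\<in>{- int N..int N}. if N = nat (k\<^sup>2) then (- 1) ^ nat \<bar>k\<bar> else (0 :: 'a))"
    by (simp add: theta_def fps_sum_nth minus_one_power_mult_X_power_nth)
  also have "\<dots> = (\<Sum>k\<in>?A. (- 1) ^ nat \<bar>k\<bar>)"
    by (rule sum.inter_filter[symmetric]) simp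
  also have "\<dots> = (\<Sum>k\<in>?A. (- 1) ^ N)"
    using par by (intro sum.cong refl minus_one_power_cong)
  also have "\<dots> = of_nat (card ?A) * (- 1) ^ N"
    by (rule sum_constant)
  also have "card ?A = 2 * of_bool (is_square N)"
  proof (cases "is_square N")
    case False
    have "?A = {}"
    proof (rule ccontr)
      assume "?A \<noteq> {}"
      then obtain k where "N = nat (k\<^sup>2)" by blast
      then have "N = (nat \<bar>k\<bar>)\<^sup>2" by (simp flip: nat_power_eq)
      with False show False by (auto simp: is_nth_power_def)
    qed
    then have "card ?A = 0" by (simp only: card.empty)
    then show ?thesis using False by simp
  next
    case True
    then obtain r where r: "N = r\<^sup>2" by (auto simp: is_nth_power_def)
    with assms have "r > 0" by (cases r) auto
    have "?A = {int r, - int r}"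
    proof -
      have "k = int r \<or> k = - int r" if "N = nat (k\<^sup>2)" for k
      proof -
        have "k\<^sup>2 = (int r)\<^sup>2" using that r by (simp flip: of_nat_power)
        then show ?thesis by (simp add: power2_eq_iff)
      qed
      \<comment> \<open>Both roots lie within the truncation of \<open>theta N\<close>.\<close>
      moreover have "r \<le> N"
        using self_le_power[of r 2] \<open>r > 0\<close> r by simp
      then have "int r \<in> {- int N..int N}" "- int r \<in> {- int N..int N}"
        by auto
      moreover have "N = nat ((int r)\<^sup>2)" "N = nat ((- int r)\<^sup>2)"
        using r by (simp_all add: nat_power_eq)
      ultimately show ?thesis by blast
    qed
    then have "card ?A = card {int r, - int r}" by (simp only:)
    with \<open>r > 0\<close> True show ?thesis by simp
  qed
  finally show ?thesis by simp
qed

text \<open>The sign of a lattice point depends on x + y, which has the parity of x^2 + y^2 = N, so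
  it is constant on the circle.\<close>

lemma theta_square_nth_self: "(theta N * theta N) $ N = (- 1) ^ N * (of_nat (r2 N) :: 'a::field)"
proof -
  let ?I = "{- int N..int N}"
  let ?A = "{(x, y). x\<^sup>2 + y\<^sup>2 = int N}"
  have term_eq: "((- 1) ^ nat \<bar>x\<bar> * fps_X ^ nat (x\<^sup>2)) * ((- 1) ^ nat \<bar>y\<bar> * fps_X ^ nat (y\<^sup>2))
      = (- 1) ^ (nat \<bar>x\<bar> + nat \<bar>y\<bar>) * (fps_X ^ nat (x\<^sup>2 + y\<^sup>2) :: 'a fps)" for x y
    by (simp add: power_add nat_add_distrib)
  have par: "even (nat \<bar>x\<bar> + nat \<bar>y\<bar>) \<longleftrightarrow> even N" if "x\<^sup>2 + y\<^sup>2 = int N" for x y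
  proof -
    have "even (int N) \<longleftrightarrow> even (x\<^sup>2 + y\<^sup>2)" using that by simp
    then show ?thesis by (simp add: even_nat_iff)
  qed
  have le: "\<bar>x\<bar> \<le> x\<^sup>2" for x :: int
    using self_le_power[of "\<bar>x\<bar>" 2] by (cases "x = 0") auto
  \<comment> \<open>The truncation loses no lattice point of the circle, because |x| <= x^2 <= N and
    likewise for y.\<close>
  have sub: "?A \<subseteq> ?I \<times> ?I"
  proof clarify
    fix x y :: int assume "x\<^sup>2 + y\<^sup>2 = int N"
    then show "x \<in> ?I \<and> y \<in> ?I"
      using le[of x] le[of y] zero_le_power2[of x] zero_le_power2[of y]
      unfolding atLeastAtMost_iff by linarith
  qed
  have nat_iff: "N = nat (x\<^sup>2 + y\<^sup>2) \<longleftrightarrow> x\<^sup>2 + y\<^sup>2 = int N" for x y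
    by auto
  have "(theta N * theta N) $ N =
      (\<Sum>(x, y)\<in>?I \<times> ?I. if x\<^sup>2 + y\<^sup>2 = int N then (- 1) ^ (nat \<bar>x\<bar> + nat \<bar>y\<bar>) else (0 :: 'a))"
    unfolding theta_def sum_product term_eq fps_sum_nth sum.cartesian_product
    by (intro sum.cong refl) (auto simp: minus_one_power_mult_X_power_nth nat_iff)
  also have "\<dots> = (\<Sum>(x, y)\<in>?A. (- 1) ^ (nat \<bar>x\<bar> + nat \<bar>y\<bar>))"
    using sub by (intro sum.mono_neutral_cong_right) (auto split: if_splits)
  also have "\<dots> = (\<Sum>z\<in>?A. (- 1) ^ N)"
    using par by (intro sum.cong refl) (auto intro!: minus_one_power_cong)
  finally show ?thesis by (simp add: r2_def)
qed

section \<open>Back to the sum over partitions\<close>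

text \<open>Modulo 2, both sides count the odd parts. This trades the sign of the even parts for the
  sign of all parts, up to (-1)^N.\<close>

lemma even_length_iff: "even (length p + num_even_parts p) \<longleftrightarrow> even (sum_list p)"
  by (induction p) (auto simp: num_even_parts_def)

text \<open>Partitions of N are grouped by smallest part, which lies between 1 and N; hence m < N
  with the shift \<open>Suc m\<close>.\<close>

lemma sum_over_smallest_part:
  "(\<Sum>m<N. (- 1) ^ m * smallest_gf (Suc m)) $ N =
     (\<Sum>p | p \<in> nonempty_partitions \<and> sum_list p = N.
        (- 1) ^ (smallest_part p + 1) * (part_weight p :: 'a::comm_ring_1))"
proof -
  let ?U = "{p \<in> nonempty_partitions. sum_list p = N}"
  let ?B = "\<lambda>m. {p \<in> parts_from (Suc m) N. Suc m \<in> set p}"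
  have B: "?B m = {p \<in> ?U. smallest_part p = Suc m}" for m
  proof (intro equalityI subsetI)
    fix p assume p: "p \<in> ?B m"
    then have "Min (set p) = Suc m" by (intro Min_eqI) (auto simp: parts_from_def)
    with p show "p \<in> {p \<in> ?U. smallest_part p = Suc m}"
      by (auto simp: parts_from_def nonempty_partitions_def smallest_part_def)
  next
    fix p assume p: "p \<in> {p \<in> ?U. smallest_part p = Suc m}"
    then have "Min (set p) = Suc m" "set p \<noteq> {}"
      by (auto simp: smallest_part_def nonempty_partitions_def)
    then have "Suc m \<in> set p" "\<forall>x\<in>set p. Suc m \<le> x"
      by (metis List.finite_set Min_in, metis List.finite_set Min_le)
    with p show "p \<in> ?B m" by (auto simp: parts_from_def nonempty_partitions_def)
  qed
  have range: "smallest_part p - 1 \<in> {..<N}" "smallest_part p > 0" if "p \<in> ?U" for p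
  proof -
    have "smallest_part p \<in> set p"
      using that by (auto simp: nonempty_partitions_def smallest_part_def intro!: Min_in)
    moreover from this have "smallest_part p \<le> sum_list p"
      by (rule member_le_sum_list) simp
    ultimately show "smallest_part p - 1 \<in> {..<N}" "smallest_part p > 0"
      using that by (auto simp: nonempty_partitions_def is_partition_def)
  qed
  have "(\<Sum>m<N. (- 1) ^ m * smallest_gf (Suc m) :: 'a fps) $ N
      = (\<Sum>m<N. \<Sum>p\<in>?B m. (- 1) ^ m * part_weight p)"
    unfolding fps_sum_nth
  proof (rule sum.cong)
    fix m
    have "(- 1) ^ m = fps_const ((- 1) ^ m :: 'a)"
      by (simp flip: fps_const_power fps_const_neg)
    then show "((- 1) ^ m * smallest_gf (Suc m) :: 'a fps) $ N
        = (\<Sum>p\<in>?B m. (- 1) ^ m * part_weight p)"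
      by (simp add: smallest_gf_def sum_distrib_left)
  qed simp
  \<comment> \<open>Brought into the shape of \<open>sum.group\<close>; the truncated subtraction is
    harmless because smallest parts are positive.\<close>
  also have "\<dots> = (\<Sum>m<N. \<Sum>p | p \<in> ?U \<and> smallest_part p - 1 = m.
                    (- 1) ^ (smallest_part p + 1) * part_weight p)"
  proof (rule sum.cong)
    fix m
    have "p \<in> ?B m \<longleftrightarrow> p \<in> ?U \<and> smallest_part p - 1 = m" for p
      using range(2)[of p] unfolding B by auto
    then have sets: "?B m = {p. p \<in> ?U \<and> smallest_part p - 1 = m}" by blast
    have sign: "(- 1) ^ m * part_weight p = (- 1) ^ (smallest_part p + 1) * (part_weight p :: 'a)"
      if "p \<in> ?B m" for p
    proof -
      have "smallest_part p = Suc m" using that unfolding B by simp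
      then show ?thesis by simp
    qed
    show "(\<Sum>p\<in>?B m. (- 1) ^ m * part_weight p :: 'a)
        = (\<Sum>p | p \<in> ?U \<and> smallest_part p - 1 = m. (- 1) ^ (smallest_part p + 1) * part_weight p)"
      unfolding sets[symmetric] by (intro sum.cong refl sign)
  qed simp
  also have "\<dots> = (\<Sum>p\<in>?U. (- 1) ^ (smallest_part p + 1) * part_weight p)"
    using range(1) by (intro sum.group finite_nonempty_partitions_of) auto
  finally show ?thesis .
qed

theorem theorem4p6:
  fixes N :: nat
  assumes "N > 0"
  shows "(\<Sum>p | p \<in> nonempty_partitions \<and> sum_list p = N.
            (-1 :: int) ^ (smallest_part p + num_even_parts p + 1) * 2 ^ num_distinct_parts p)
         = int (r2 N) - 2 * of_bool (is_square N)"
proof -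
  let ?U = "{p. p \<in> nonempty_partitions \<and> sum_list p = N}"
  let ?w = "\<lambda>p. (- 1) ^ (smallest_part p + num_even_parts p + 1) * 2 ^ num_distinct_parts p :: int"
  \<comment> \<open>The series identities live over a field, so the sum is computed in
    \<open>rat\<close> and pulled back along the injection \<open>of_int\<close>.\<close>
  have weight: "of_int (?w p) = (- 1) ^ N * ((- 1) ^ (smallest_part p + 1) * part_weight p :: rat)"
    if "p \<in> ?U" for p
  proof -
    have "even (length p + num_even_parts p) \<longleftrightarrow> even N"
      using that even_length_iff by simp
    then have "(- 1 :: rat) ^ (smallest_part p + num_even_parts p + 1)
        = (- 1) ^ (N + (smallest_part p + 1) + length p)"
      by (intro minus_one_power_cong) auto
    then show ?thesis
      by (simp add: part_weight_def num_distinct_parts_def power_add)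
  qed
  have "of_int (\<Sum>p\<in>?U. ?w p)
      = (- 1) ^ N * (\<Sum>m<N. (- 1) ^ m * smallest_gf (Suc m) :: rat fps) $ N"
    unfolding sum_over_smallest_part sum_distrib_left of_int_sum
    by (intro sum.cong refl weight)
  also have "(\<Sum>m<N. (- 1) ^ m * smallest_gf (Suc m) :: rat fps) $ N
      = (theta N * theta N - theta N) $ N"
    using sum_smallest_gf_eq_theta[of N, where 'a=rat] by (simp add: eq_upto_def)
  also have "\<dots> = (- 1) ^ N * (of_nat (r2 N) - 2 * of_bool (is_square N))"
    using assms by (simp add: theta_square_nth_self theta_nth_self algebra_simps)
  \<comment> \<open>The sign from the change of weight meets the sign of the theta coefficients, and
    (-1)^N (-1)^N = 1.\<close>
  also have "(- 1) ^ N * \<dots> = of_int (int (r2 N) - 2 * of_bool (is_square N))"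
    by (simp add: mult.assoc[symmetric] flip: power_add)
  finally show ?thesis
    by (simp only: of_int_eq_iff)
qed

end
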